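(* Let $\{\phi_t\colon\mathbb{D}\to\mathbb{D}\}_{t\ge 0}$ be a parabolic semigroup of holomorphic self-maps of $\mathbb{D}$ of finite shift whose Denjoy-Wolff point is $\tau\in\partial\mathbb{D}$. Then there exists a constant $C=C(\phi_1)>0$ such that $$t\,|\phi_t-\tau|\to C, \quad t\to+\infty,$$ uniformly on compact subsets of $\mathbb{D}$.
   Context: $\mathbb{D}$ is the open unit disk. A (continuous) semigroup of holomorphic self-maps of $\mathbb{D}$ is a family $\{\phi_t\}_{t\ge0}$ of holomorphic maps $\phi_t\colon\mathbb{D}\to\mathbb{D}$ with $\phi_0=\mathrm{Id}$, $\phi_{t+s}=\phi_t\circ\phi_s$ for all $s,t\ge0$, and $\phi_t\to\mathrm{Id}$ uniformly on compact subsets of $\mathbb{D}$ as $t\to0^+$. If $\phi_t$ has no fixed point in $\mathbb{D}$ for $t>0$ (non-elliptic semigroup), then there is a point $\tau\in\partial\mathbb{D}$, the Denjoy-Wolff point of the semigroup, such that $\phi_t\to\tau$ uniformly on compact subsets of $\mathbb{D}$ as $t\to+\infty$; it is the Denjoy-Wolff point (the limit of the iterates) of each $\phi_t$, $t>0$. The semigroup is parabolic if it is non-elliptic and each $\phi_t$, $t>0$ (equivalently $\phi_1$), is parabolic, meaning that with $S(z)=i\frac{\tau+z}{\tau-z}$, mapping $\mathbb{D}$ onto the upper half-plane, the map $f=S\circ\phi_t\circ S^{-1}$ has angular (non-tangential) limit $\angle\lim_{w\to\infty}f(w)/w=1$. A parabolic semigroup is of finite shift if there exist $z_0\in\mathbb{D}$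 and a horocycle $\{z\in\mathbb{D}:|\tau-z|^2/(1-|z|^2)<R\}$, $R>0$, of center $\tau$ in which the orbit $\{\phi_t(z_0):t\ge0\}$ does not enter; equivalently, the map $\phi_1$ is of finite shift (some orbit of iterates of $\phi_1$ does not enter some horocycle of center $\tau$). *)

theory Defs
  imports "HOL-Complex_Analysis.Complex_Analysis" "HOL-Library.FuncSet"
begin

abbreviation unit_disk :: "complex set" where
  "unit_disk \<equiv> ball 0 1"

text \<open>
  Self-maps of the disk are represented by total functions on the complex plane;
  only their values on the disk are constrained.
\<close>

definition holomorphic_semigroup :: "(real \<Rightarrow> complex \<Rightarrow> complex) \<Rightarrow> bool" where
  "holomorphic_semigroup \<phi> \<longleftrightarrow>
     (\<forall>t\<ge>0. \<phi> t holomorphic_on unit_disk \<and> \<phi> t ` unit_disk \<subseteq> unit_disk) \<and>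
     (\<forall>z\<in>unit_disk. \<phi> 0 z = z) \<and>
     (\<forall>s\<ge>0. \<forall>t\<ge>0. \<forall>z\<in>unit_disk. \<phi> (t + s) z = \<phi> t (\<phi> s z)) \<and>
     (\<forall>K. compact K \<and> K \<subseteq> unit_disk \<longrightarrow> uniform_limit K \<phi> (\<lambda>z. z) (at_right 0))"

definition nonelliptic_semigroup :: "(real \<Rightarrow> complex \<Rightarrow> complex) \<Rightarrow> bool" where
  "nonelliptic_semigroup \<phi> \<longleftrightarrow>
     holomorphic_semigroup \<phi> \<and> (\<forall>t>0. \<forall>z\<in>unit_disk. \<phi> t z \<noteq> z)"

definition Denjoy_Wolff_point :: "(real \<Rightarrow> complex \<Rightarrow> complex) \<Rightarrow> complex \<Rightarrow> bool" where
  "Denjoy_Wolff_point \<phi> \<tau> \<longleftrightarrow>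
     \<tau> \<in> sphere 0 1 \<and>
     (\<forall>K. compact K \<and> K \<subseteq> unit_disk \<longrightarrow> uniform_limit K \<phi> (\<lambda>_. \<tau>) at_top)"

definition cayley :: "complex \<Rightarrow> complex \<Rightarrow> complex" where
  "cayley \<tau> z = \<i> * (\<tau> + z) / (\<tau> - z)"

text \<open>
  Angular limit at infinity of a function on the upper half-plane: the limit at infinity
  inside every sector with vertex at the origin whose closure meets the real axis only there.
\<close>

definition angular_limit_at_infinity :: "(complex \<Rightarrow> complex) \<Rightarrow> complex \<Rightarrow> bool" where
  "angular_limit_at_infinity g l \<longleftrightarrow>
     (\<forall>\<theta>. 0 < \<theta> \<and> \<theta> < pi / 2 \<longrightarrow>
        (g \<longlongrightarrow> l) (inf at_infinity (principal {w. \<theta> < Arg w \<and> Arg w < pi - \<theta>})))"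

definition parabolic_map :: "complex \<Rightarrow> (complex \<Rightarrow> complex) \<Rightarrow> bool" where
  "parabolic_map \<tau> h \<longleftrightarrow>
     angular_limit_at_infinity
       (\<lambda>w. cayley \<tau> (h (inv_into unit_disk (cayley \<tau>) w)) / w) 1"

definition parabolic_semigroup :: "(real \<Rightarrow> complex \<Rightarrow> complex) \<Rightarrow> complex \<Rightarrow> bool" where
  "parabolic_semigroup \<phi> \<tau> \<longleftrightarrow>
     nonelliptic_semigroup \<phi> \<and> Denjoy_Wolff_point \<phi> \<tau> \<and> (\<forall>t>0. parabolic_map \<tau> (\<phi> t))"

definition horocycle :: "complex \<Rightarrow> real \<Rightarrow> complex set" where
  "horocycle \<tau> R = {z \<in> unit_disk. (cmod (\<tau> - z))\<^sup>2 / (1 - (cmod z)\<^sup>2) < R}"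

definition finite_shift :: "(real \<Rightarrow> complex \<Rightarrow> complex) \<Rightarrow> complex \<Rightarrow> bool" where
  "finite_shift \<phi> \<tau> \<longleftrightarrow>
     (\<exists>z\<^sub>0\<in>unit_disk. \<exists>R>0. \<forall>t\<ge>0. \<phi> t z\<^sub>0 \<notin> horocycle \<tau> R)"

end

theory Submission
  imports Defs "HOL-Real_Asymp.Real_Asymp"
begin

text \<open>
  Write \<open>S = cayley \<tau>\<close>. Since \<open>\<bar>z - \<tau>\<bar> = 2 / \<bar>S z + \<i>\<bar>\<close> (\<open>cmod_boundary_point_diff\<close>), it is
  enough to show that the orbits \<open>S (\<phi> t z)\<close> in the upper half-plane escape to infinity with a
  nonzero linear speed: \<open>S (\<phi> t z) / t\<close> converges to some \<open>\<gamma> \<noteq> 0\<close>, locally uniformly in \<open>z\<close>.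
  Then \<open>C = 2 / \<bar>\<gamma>\<bar>\<close>. Everything rests on the Schwarz-Pick inequality for maps from the disk
  into the closed half-plane (\<open>half_plane_Schwarz_Pick\<close>).

  By Julia's inequality at the Denjoy-Wolff point (\<open>Julia_inequality\<close>), \<open>Im (S (\<phi> t z))\<close> is
  nondecreasing in \<open>t\<close>; finite shift says that it is bounded along one orbit, that of \<open>z\<^sub>0\<close>.
  Fix a time step \<open>h > 0\<close> and put \<open>a\<^sub>n = S (\<phi> (n h) z\<^sub>0)\<close>, \<open>y\<^sub>n = Im a\<^sub>n\<close>,
  \<open>d\<^sub>n = a\<^sub>n\<^sub>+\<^sub>1 - a\<^sub>n\<close>, and let \<open>l\<close> be the limit of \<open>y\<^sub>n\<close>. Julia's inequality says that the
  displacement \<open>S \<circ> \<phi> (m h) - S\<close> itself maps into the closed half-plane, and its imaginary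
  part at the \<open>n\<close>-th orbit point is \<open>y\<^sub>m\<^sub>+\<^sub>n - y\<^sub>n \<le> l - y\<^sub>n\<close>, which is small for large \<open>n\<close>,
  uniformly in \<open>m\<close>. Schwarz-Pick for the displacement at two consecutive orbit points
  (\<open>displacement_Schwarz_Pick\<close>) thus yields
  \<open>\<bar>d\<^sub>m\<^sub>+\<^sub>n - d\<^sub>n\<bar> \<le> \<epsilon>\<^sub>n \<bar>d\<^sub>n\<bar>\<close> for all \<open>m\<close>, where \<open>\<epsilon>\<^sub>n\<close> tends to \<open>0\<close>.
  Because this error is relative to \<open>\<bar>d\<^sub>n\<bar>\<close>, it gives both that \<open>d\<^sub>n\<close> is a Cauchy sequence and
  that its limit \<open>\<beta>\<close> is nonzero: \<open>d\<^sub>n\<close> does not vanish, for there are no fixed points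
  (\<open>increments_converge_to_nonzero\<close>). Averaging, \<open>a\<^sub>n / n\<close> tends to \<open>\<beta>\<close>.

  The passage to all starting points and all real times costs only a bounded error: \<open>\<phi> t\<close>
  contracts the hyperbolic distance, and since the orbit of \<open>z\<^sub>0\<close> has bounded height, points at
  bounded hyperbolic distance from it are at bounded Euclidean distance (\<open>orbits_stay_close\<close>).
  Finally, \<open>C\<close> can be read off from the iterates of \<open>\<phi> 1\<close> at \<open>0\<close>, so it depends on \<open>\<phi> 1\<close> only.
\<close>

section \<open>The Schwarz-Pick inequality for maps into the half-plane\<close>

text \<open>
  This is \<open>4 (sinh (\<rho> / 2))\<^sup>2\<close> for the hyperbolic distance \<open>\<rho>\<close> of curvature \<open>-1\<close>. It is
  used in place of \<open>\<rho>\<close> because in half-plane coordinates it is the rational expression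
  \<open>\<bar>a - b\<bar>\<^sup>2 / (Im a * Im b)\<close>; see \<open>hyperbolic_gap_cayley\<close> below.
\<close>

definition hyperbolic_gap :: "complex \<Rightarrow> complex \<Rightarrow> real" where
  "hyperbolic_gap z w = 4 * (cmod (z - w))\<^sup>2 / ((1 - (cmod z)\<^sup>2) * (1 - (cmod w)\<^sup>2))"

lemma one_minus_cmod_square_pos: "z \<in> unit_disk \<Longrightarrow> 0 < 1 - (cmod z)\<^sup>2"
  by (simp add: abs_square_less_1)

lemma hyperbolic_gap_nonneg:
  "z \<in> unit_disk \<Longrightarrow> w \<in> unit_disk \<Longrightarrow> 0 \<le> hyperbolic_gap z w"
  using one_minus_cmod_square_pos[of z] one_minus_cmod_square_pos[of w]
  by (simp add: hyperbolic_gap_def)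

lemma cmod_diff_cnj_square: "(cmod (a - cnj b))\<^sup>2 = (cmod (a - b))\<^sup>2 + 4 * Im a * Im b"
  unfolding cmod_power2 by (simp add: power2_eq_square algebra_simps)

lemma cmod_one_minus_cnj_mult_square:
  "(cmod (1 - cnj w * z))\<^sup>2 = (cmod (z - w))\<^sup>2 + (1 - (cmod z)\<^sup>2) * (1 - (cmod w)\<^sup>2)"
  unfolding cmod_power2 by (simp add: power2_eq_square algebra_simps)

lemma divide_le_divide_iff_pos:
  fixes a b c d :: real
  assumes "0 < b" "0 < d"
  shows "a / b \<le> c / d \<longleftrightarrow> a * d \<le> c * b"
  using assms by (simp add: field_simps)

text \<open>
  The Schwarz lemma, applied to \<open>F\<close> preceded by a disk automorphism taking \<open>0\<close> to \<open>w\<close> and followed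
  by the map of the half-plane onto the disk that takes \<open>F w\<close> to \<open>0\<close>, compares the pseudohyperbolic
  distances. Both of these have the form \<open>A / (A + c)\<close> after squaring, and clearing
  denominators leaves an inequality between the gaps.
\<close>

lemma half_plane_Schwarz_Pick_strict:
  assumes hol: "F holomorphic_on unit_disk"
    and pos: "\<And>z. z \<in> unit_disk \<Longrightarrow> 0 < Im (F z)"
    and z: "z \<in> unit_disk" and w: "w \<in> unit_disk"
  shows "(cmod (F z - F w))\<^sup>2 \<le> hyperbolic_gap z w * (Im (F z) * Im (F w))"
proof -
  define M where "M = Moebius_function 0 (- w)"
  define T where "T = (\<lambda>\<zeta>. (\<zeta> - F w) / (\<zeta> - cnj (F w)))"
  have w1: "cmod w < 1" and z1: "cmod z < 1"
    using w z by auto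
  have M_ball: "M x \<in> unit_disk" if "x \<in> unit_disk" for x
    using that w1 by (simp add: M_def Moebius_function_norm_lt_1)
  have M0: "M 0 = w"
    by (simp add: M_def Moebius_function_simple)
  define u where "u = Moebius_function 0 w z"
  have u1: "cmod u < 1"
    using w1 z1 by (simp add: u_def Moebius_function_norm_lt_1)
  have Mu: "M u = z"
    using Moebius_function_compose[of "- w" w z] w1 z1
    by (simp add: M_def u_def)
  have T_bound: "F x - cnj (F w) \<noteq> 0" "cmod (T (F x)) < 1" if "x \<in> unit_disk" for x
  proof -
    have "0 < Im (F x) * Im (F w)"
      using pos[OF that] pos[OF w] by simp
    then have less: "(cmod (F x - F w))\<^sup>2 < (cmod (F x - cnj (F w)))\<^sup>2"
      by (simp add: cmod_diff_cnj_square mult.commute)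
    then have less': "cmod (F x - F w) < cmod (F x - cnj (F w))"
      using power2_less_imp_less by fastforce
    then show "F x - cnj (F w) \<noteq> 0"
      using norm_ge_zero[of "F x - F w"] by fastforce
    then show "cmod (T (F x)) < 1"
      using less' by (simp add: T_def norm_divide)
  qed
  have "(\<lambda>x. T (F (M x))) holomorphic_on unit_disk"
  proof -
    have "M holomorphic_on unit_disk"
      using w1 by (simp add: M_def Moebius_function_holomorphic)
    then have "(F \<circ> M) holomorphic_on unit_disk"
      using M_ball by (intro holomorphic_on_compose_gen[OF _ hol]) auto
    then have "(\<lambda>x. F (M x)) holomorphic_on unit_disk"
      by (simp add: o_def)
    then show ?thesis
      unfolding T_def using T_bound(1) M_ball by (intro holomorphic_intros) auto
  qed
  moreover have "T (F (M 0)) = 0"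
    by (simp add: M0 T_def)
  ultimately have "cmod (T (F (M u))) \<le> cmod u"
    using Schwarz_Lemma(1)[of "\<lambda>x. T (F (M x))" u] T_bound(2) M_ball u1 by simp
  then have Tu: "cmod (T (F z)) \<le> cmod u"
    by (simp add: Mu)
  define A where "A = (cmod (F z - F w))\<^sup>2"
  define B where "B = (cmod (z - w))\<^sup>2"
  define P where "P = Im (F z) * Im (F w)"
  define E where "E = (1 - (cmod z)\<^sup>2) * (1 - (cmod w)\<^sup>2)"
  have pos': "0 < P" "0 < E" "0 \<le> A" "0 \<le> B"
    using pos z w one_minus_cmod_square_pos by (simp_all add: P_def E_def A_def B_def)
  have "(cmod (T (F z)))\<^sup>2 = A / (A + 4 * P)"
    by (simp add: T_def A_def P_def norm_divide power_divide cmod_diff_cnj_square mult.assoc)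
  moreover have "(cmod u)\<^sup>2 = B / (B + E)"
    by (simp add: u_def B_def E_def Moebius_function_simple norm_divide power_divide
        cmod_one_minus_cnj_mult_square)
  ultimately have "A / (A + 4 * P) \<le> B / (B + E)"
    using power_mono[OF Tu, of 2] by simp
  then have "A * (B + E) \<le> B * (A + 4 * P)"
    using pos' by (simp add: divide_le_divide_iff_pos)
  then have "A * E \<le> 4 * B * P"
    by (simp add: algebra_simps)
  then have "A \<le> 4 * B / E * P"
    using pos' by (simp add: field_simps)
  then show ?thesis
    by (simp add: A_def B_def P_def E_def hyperbolic_gap_def)
qed

text \<open>
  Displacements \<open>S \<circ> \<phi> t - S\<close> may have real values, so the version for the closed
  half-plane is needed; it follows by applying the strict one to \<open>F + \<i> e\<close> with \<open>e\<close> tending to \<open>0\<close>.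
\<close>

lemma half_plane_Schwarz_Pick:
  assumes hol: "F holomorphic_on unit_disk"
    and nonneg: "\<And>z. z \<in> unit_disk \<Longrightarrow> 0 \<le> Im (F z)"
    and z: "z \<in> unit_disk" and w: "w \<in> unit_disk"
  shows "(cmod (F z - F w))\<^sup>2 \<le> hyperbolic_gap z w * (Im (F z) * Im (F w))"
proof (rule tendsto_lowerbound)
  show "((\<lambda>e. hyperbolic_gap z w * ((Im (F z) + e) * (Im (F w) + e)))
          \<longlongrightarrow> hyperbolic_gap z w * (Im (F z) * Im (F w))) (at_right 0)"
    by (auto intro!: tendsto_eq_intros)
  show "\<forall>\<^sub>F e in at_right 0. (cmod (F z - F w))\<^sup>2
          \<le> hyperbolic_gap z w * ((Im (F z) + e) * (Im (F w) + e))"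
    using eventually_at_right_less
  proof eventually_elim
    case (elim e)
    have "(\<lambda>x. F x + \<i> * of_real e) holomorphic_on unit_disk"
      using hol by (intro holomorphic_intros)
    moreover have "0 < Im (F x + \<i> * of_real e)" if "x \<in> unit_disk" for x
      using nonneg[OF that] elim by simp
    ultimately show ?case
      using half_plane_Schwarz_Pick_strict[of "\<lambda>x. F x + \<i> * of_real e", OF _ _ z w] by simp
  qed
qed simp

section \<open>The Cayley transform\<close>

lemma boundary_point_neq: "\<tau> \<in> sphere 0 1 \<Longrightarrow> z \<in> unit_disk \<Longrightarrow> \<tau> \<noteq> z"
  by auto

lemma Im_cayley:
  assumes "\<tau> \<in> sphere 0 1" "z \<in> unit_disk"
  shows "Im (cayley \<tau> z) = (1 - (cmod z)\<^sup>2) / (cmod (\<tau> - z))\<^sup>2"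
proof -
  have "Im (cayley \<tau> z) = Re ((\<tau> + z) / (\<tau> - z))"
    by (simp add: cayley_def flip: times_divide_eq_right)
  also have "\<dots> = Re ((\<tau> + z) * cnj (\<tau> - z)) / (cmod (\<tau> - z))\<^sup>2"
    by (simp add: complex_div_cnj[of "\<tau> + z"] flip: of_real_power)
  also have "Re ((\<tau> + z) * cnj (\<tau> - z)) = (cmod \<tau>)\<^sup>2 - (cmod z)\<^sup>2"
    unfolding cmod_power2 by (simp add: algebra_simps power2_eq_square)
  finally show ?thesis
    using assms by simp
qed

lemma Im_cayley_pos:
  assumes "\<tau> \<in> sphere 0 1" "z \<in> unit_disk"
  shows "0 < Im (cayley \<tau> z)"
  using assms one_minus_cmod_square_pos[of z] boundary_point_neq[of \<tau> z]
  by (simp add: Im_cayley)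

lemma cayley_plus_ii: "\<tau> \<noteq> z \<Longrightarrow> cayley \<tau> z + \<i> = 2 * \<i> * \<tau> / (\<tau> - z)"
  by (simp add: cayley_def field_simps)

lemma cmod_boundary_point_diff:
  assumes "\<tau> \<in> sphere 0 1" "z \<in> unit_disk"
  shows "cmod (z - \<tau>) = 2 / cmod (cayley \<tau> z + \<i>)"
  using assms boundary_point_neq[OF assms]
  by (simp add: cayley_plus_ii norm_divide norm_mult norm_minus_commute)

lemma cayley_holomorphic:
  assumes "\<tau> \<in> sphere 0 1"
  shows "cayley \<tau> holomorphic_on unit_disk"
proof -
  have "(\<lambda>z. \<i> * (\<tau> + z) / (\<tau> - z)) holomorphic_on unit_disk"
    using assms boundary_point_neq by (intro holomorphic_intros) auto
  then show ?thesis
    by (simp add: cayley_def[abs_def])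
qed

lemma cayley_diff:
  assumes "\<tau> \<noteq> z" "\<tau> \<noteq> w"
  shows "cayley \<tau> z - cayley \<tau> w = 2 * \<i> * \<tau> * (z - w) / ((\<tau> - z) * (\<tau> - w))"
  using assms by (simp add: cayley_def field_simps)

lemma hyperbolic_gap_cayley:
  assumes "\<tau> \<in> sphere 0 1" "z \<in> unit_disk" "w \<in> unit_disk"
  shows "(cmod (cayley \<tau> z - cayley \<tau> w))\<^sup>2 =
    hyperbolic_gap z w * (Im (cayley \<tau> z) * Im (cayley \<tau> w))"
proof -
  have neq: "\<tau> \<noteq> z" "\<tau> \<noteq> w"
    using assms boundary_point_neq by blast+
  have pos: "1 - (cmod z)\<^sup>2 \<noteq> 0" "1 - (cmod w)\<^sup>2 \<noteq> 0"
    using one_minus_cmod_square_pos assms by force+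
  have "(cmod (cayley \<tau> z - cayley \<tau> w))\<^sup>2 =
      4 * (cmod (z - w))\<^sup>2 / ((cmod (\<tau> - z))\<^sup>2 * (cmod (\<tau> - w))\<^sup>2)"
    using assms by (simp add: cayley_diff neq norm_divide norm_mult power_divide power_mult_distrib)
  also have "\<dots> = hyperbolic_gap z w * (Im (cayley \<tau> z) * Im (cayley \<tau> w))"
    using assms pos by (simp add: Im_cayley hyperbolic_gap_def)
  finally show ?thesis .
qed

lemma cayley_inj:
  assumes "\<tau> \<in> sphere 0 1" "z \<in> unit_disk" "w \<in> unit_disk" "cayley \<tau> z = cayley \<tau> w"
  shows "z = w"
  using cayley_diff[of \<tau> z w] boundary_point_neq assms by force

text \<open>
  This is the classical Schwarz-Pick lemma. Here any boundary point could serve to pass to the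
  half-plane, as the gap does not see the choice.
\<close>

lemma hyperbolic_gap_contraction:
  assumes hol: "h holomorphic_on unit_disk" and self: "h ` unit_disk \<subseteq> unit_disk"
    and z: "z \<in> unit_disk" and w: "w \<in> unit_disk"
  shows "hyperbolic_gap (h z) (h w) \<le> hyperbolic_gap z w"
proof -
  have one: "(1::complex) \<in> sphere 0 1"
    by simp
  have h: "h x \<in> unit_disk" if "x \<in> unit_disk" for x
    using self that by blast
  have "(cayley 1 \<circ> h) holomorphic_on unit_disk"
    using holomorphic_on_compose_gen[OF hol cayley_holomorphic[OF one] self] .
  then have "(cmod (cayley 1 (h z) - cayley 1 (h w)))\<^sup>2
      \<le> hyperbolic_gap z w * (Im (cayley 1 (h z)) * Im (cayley 1 (h w)))"
    using half_plane_Schwarz_Pick_strict[of "cayley 1 \<circ> h", OF _ _ z w] Im_cayley_pos[OF one] h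
    by simp
  moreover have "0 < Im (cayley 1 (h z)) * Im (cayley 1 (h w))"
    using Im_cayley_pos[OF one] h z w by simp
  ultimately show ?thesis
    using hyperbolic_gap_cayley[OF one h[OF z] h[OF w]] by (metis mult_right_le_imp_le)
qed

lemma tendsto_eventually_less:
  fixes f g :: "'a \<Rightarrow> real"
  assumes "l < m" "(f \<longlongrightarrow> l) F" "(g \<longlongrightarrow> m) F"
  shows "\<forall>\<^sub>F x in F. f x < g x"
  using order_tendstoD(1)[OF tendsto_diff[OF assms(3,2)], of 0] assms(1) by simp

section \<open>Julia's inequality at the Denjoy-Wolff point\<close>

text \<open>
  Horocycles at \<open>\<tau>\<close> are limits of hyperbolic disks centered at points tending to \<open>\<tau>\<close>. If an
  orbit of \<open>h\<close> itself supplies the centers \<open>z n\<close>, the contraction property compares the disk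
  around \<open>z n\<close> with the one around \<open>z (Suc n)\<close>. The factors \<open>1 - \<bar>z n\<bar>\<^sup>2\<close> and \<open>1 - \<bar>z (Suc n)\<bar>\<^sup>2\<close>
  do not cancel, but for infinitely many \<open>n\<close> they compare in the right direction.
\<close>

lemma Julia_inequality:
  fixes z :: "nat \<Rightarrow> complex"
  assumes hol: "h holomorphic_on unit_disk" and self: "h ` unit_disk \<subseteq> unit_disk"
    and \<tau>: "\<tau> \<in> sphere 0 1"
    and z: "\<And>n. z n \<in> unit_disk" and step: "\<And>n. z (Suc n) = h (z n)" and lim: "z \<longlonglongrightarrow> \<tau>"
    and x: "x \<in> unit_disk"
  shows "Im (cayley \<tau> x) \<le> Im (cayley \<tau> (h x))"
proof (rule ccontr)
  assume contra: "\<not> ?thesis"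
  have hx: "h x \<in> unit_disk"
    using self x by blast
  have pos: "0 < 1 - (cmod x)\<^sup>2" "0 < 1 - (cmod (h x))\<^sup>2"
    using x hx one_minus_cmod_square_pos by blast+
  \<comment> \<open>Otherwise the orbit would eventually move away from the circle, where its limit lies.\<close>
  have frequently: "\<exists>\<^sub>F n in sequentially. cmod (z n) \<le> cmod (z (Suc n))"
  proof (rule ccontr)
    assume "\<not> ?thesis"
    then have "\<forall>\<^sub>F n in sequentially. cmod (z (Suc n)) < cmod (z n)"
      by (simp add: not_frequently not_le)
    then obtain N where N: "\<And>n. n \<ge> N \<Longrightarrow> cmod (z (Suc n)) < cmod (z n)"
      by (auto simp: eventually_sequentially)
    have "cmod (z n) \<le> cmod (z N)" if "n \<ge> N" for n
      using that by (induction n rule: dec_induct) (auto dest: N)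
    then have "cmod \<tau> \<le> cmod (z N)"
      using tendsto_upperbound[OF tendsto_norm[OF lim], of "cmod (z N)"]
      by (auto simp: eventually_sequentially)
    then show False
      using \<tau> z[of N] by simp
  qed
  have "(cmod (x - \<tau>))\<^sup>2 * (1 - (cmod (h x))\<^sup>2) < (cmod (h x - \<tau>))\<^sup>2 * (1 - (cmod x)\<^sup>2)"
  proof -
    have "0 < (cmod (\<tau> - x))\<^sup>2" "0 < (cmod (\<tau> - h x))\<^sup>2"
      using boundary_point_neq[OF \<tau> x] boundary_point_neq[OF \<tau> hx] by auto
    moreover have "(1 - (cmod (h x))\<^sup>2) / (cmod (\<tau> - h x))\<^sup>2 < (1 - (cmod x)\<^sup>2) / (cmod (\<tau> - x))\<^sup>2"
      using contra by (simp add: Im_cayley[OF \<tau> x] Im_cayley[OF \<tau> hx])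
    ultimately show ?thesis
      by (simp add: norm_minus_commute field_simps)
  qed
  moreover have "(\<lambda>n. (cmod (x - z n))\<^sup>2 * (1 - (cmod (h x))\<^sup>2))
      \<longlonglongrightarrow> (cmod (x - \<tau>))\<^sup>2 * (1 - (cmod (h x))\<^sup>2)"
    by (intro tendsto_intros lim)
  moreover have "(\<lambda>n. (cmod (h x - z (Suc n)))\<^sup>2 * (1 - (cmod x)\<^sup>2))
      \<longlonglongrightarrow> (cmod (h x - \<tau>))\<^sup>2 * (1 - (cmod x)\<^sup>2)"
    by (intro tendsto_intros LIMSEQ_Suc[OF lim])
  ultimately have "\<forall>\<^sub>F n in sequentially. (cmod (x - z n))\<^sup>2 * (1 - (cmod (h x))\<^sup>2)
      < (cmod (h x - z (Suc n)))\<^sup>2 * (1 - (cmod x)\<^sup>2)"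
    by (rule tendsto_eventually_less)
  then obtain n where less: "(cmod (x - z n))\<^sup>2 * (1 - (cmod (h x))\<^sup>2)
      < (cmod (h x - z (Suc n)))\<^sup>2 * (1 - (cmod x)\<^sup>2)"
    and le: "cmod (z n) \<le> cmod (z (Suc n))"
    using frequently_ex[OF frequently_eventually_conj[OF frequently]] by blast
  have pos_n: "0 < 1 - (cmod (z n))\<^sup>2" "0 < 1 - (cmod (z (Suc n)))\<^sup>2"
    using z one_minus_cmod_square_pos by blast+
  have "hyperbolic_gap (h x) (z (Suc n)) \<le> hyperbolic_gap x (z n)"
    using hyperbolic_gap_contraction[OF hol self x z[of n]] by (simp add: step)
  then have "(cmod (h x - z (Suc n)))\<^sup>2 * (1 - (cmod x)\<^sup>2) * (1 - (cmod (z n))\<^sup>2)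
      \<le> (cmod (x - z n))\<^sup>2 * (1 - (cmod (h x))\<^sup>2) * (1 - (cmod (z (Suc n)))\<^sup>2)"
    using pos pos_n by (simp add: hyperbolic_gap_def divide_le_divide_iff_pos mult_ac)
  also have "\<dots> \<le> (cmod (x - z n))\<^sup>2 * (1 - (cmod (h x))\<^sup>2) * (1 - (cmod (z n))\<^sup>2)"
    using pos le by (intro mult_left_mono) (auto intro: power_mono)
  finally show False
    using less pos_n by simp
qed

section \<open>Sequences with asymptotically constant increments\<close>

text \<open>
  The hypothesis \<open>ineq\<close> bounds the change of an increment relative to its own size. The heights
  converge, so the relative error tends to \<open>0\<close>. Hence the increments neither oscillate nor
  die out once the relative error has dropped below \<open>1 / 2\<close>.
\<close>

lemma increments_converge_to_nonzero:
  fixes a :: "nat \<Rightarrow> complex"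
  assumes mono: "incseq (\<lambda>n. Im (a n))" and pos: "0 < Im (a 0)"
    and bound: "\<And>n. Im (a n) \<le> Y" and neq: "\<And>n. a (Suc n) \<noteq> a n"
    and ineq: "\<And>m n. (cmod ((a (Suc (m + n)) - a (m + n)) - (a (Suc n) - a n)))\<^sup>2
        * (Im (a n) * Im (a (Suc n)))
      \<le> (cmod (a (Suc n) - a n))\<^sup>2
        * ((Im (a (m + n)) - Im (a n)) * (Im (a (Suc (m + n))) - Im (a (Suc n))))"
  obtains \<beta> where "\<beta> \<noteq> 0" "(\<lambda>n. a (Suc n) - a n) \<longlonglongrightarrow> \<beta>"
proof -
  define d where "d = (\<lambda>n. a (Suc n) - a n)"
  define y where "y = (\<lambda>n. Im (a n))"
  obtain l where l: "y \<longlonglongrightarrow> l" "\<And>n. y n \<le> l"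
    using incseq_convergent[OF mono, of Y] bound by (auto simp: y_def)
  have y_mono: "y m \<le> y n" if "m \<le> n" for m n
    using mono that by (auto simp: y_def incseq_def)
  have y0: "0 < y 0"
    using pos by (simp add: y_def)
  have key: "cmod (d (m + n) - d n) \<le> e * cmod (d n)"
    if e: "0 \<le> e" and close: "l - y n \<le> e * y 0" for e m n
  proof -
    have "(cmod (d (m + n) - d n))\<^sup>2 * (y 0)\<^sup>2 \<le> (cmod (d (m + n) - d n))\<^sup>2 * (y n * y (Suc n))"
      unfolding power2_eq_square[of "y 0"]
      using y_mono[of 0] y0 by (intro mult_left_mono mult_mono) (auto intro: order.trans less_imp_le)
    also have "\<dots> \<le> (cmod (d n))\<^sup>2 * ((y (m + n) - y n) * (y (Suc (m + n)) - y (Suc n)))"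
      using ineq by (simp add: d_def y_def)
    also have "\<dots> \<le> (cmod (d n))\<^sup>2 * ((e * y 0) * (e * y 0))"
    proof (intro mult_left_mono mult_mono)
      show "y (m + n) - y n \<le> e * y 0"
        using l(2)[of "m + n"] close by linarith
      show "y (Suc (m + n)) - y (Suc n) \<le> e * y 0"
        using l(2)[of "Suc (m + n)"] y_mono[of n "Suc n"] close by linarith
    qed (use y_mono y0 e in \<open>auto simp: less_imp_le\<close>)
    also have "\<dots> = (e * cmod (d n))\<^sup>2 * (y 0)\<^sup>2"
      by (simp add: power2_eq_square mult_ac)
    finally have "(cmod (d (m + n) - d n))\<^sup>2 \<le> (e * cmod (d n))\<^sup>2"
      using y0 by simp
    then show ?thesis
      using e by (auto intro: power2_le_imp_le)
  qed
  have close: "\<exists>N. \<forall>n\<ge>N. l - y n \<le> e * y 0" if "0 < e" for e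
  proof -
    have "\<forall>\<^sub>F n in sequentially. l - e * y 0 < y n"
      using that y0 by (intro order_tendstoD(1)[OF l(1)]) simp
    then obtain N where "\<And>n. n \<ge> N \<Longrightarrow> l - e * y 0 < y n"
      unfolding eventually_sequentially by blast
    then show ?thesis
      by (intro exI[of _ N]) (force simp: algebra_simps)
  qed
  \<comment> \<open>From this index on, all increments stay within \<open>\<bar>d N\<bar> / 2\<close> of \<open>d N\<close>, hence away from \<open>0\<close>.\<close>
  obtain N where N: "l - y N \<le> 1 / 2 * y 0"
    using close[of "1 / 2"] by auto
  have half: "cmod (d n - d N) \<le> 1 / 2 * cmod (d N)" if "n \<ge> N" for n
    using key[OF _ N, of "n - N"] that by simp
  have dN: "0 < cmod (d N)"
    using neq by (simp add: d_def)
  have size: "cmod (d n) \<le> 2 * cmod (d N)" if "n \<ge> N" for n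
    using half[OF that] dN norm_triangle_sub[of "d n" "d N"] by linarith
  have "Cauchy d"
  proof (rule CauchyI')
    fix \<epsilon> :: real
    assume "0 < \<epsilon>"
    define e where "e = \<epsilon> / (4 * cmod (d N))"
    have e: "0 < e"
      using \<open>0 < \<epsilon>\<close> dN by (simp add: e_def)
    obtain M where M: "\<And>n. n \<ge> M \<Longrightarrow> l - y n \<le> e * y 0"
      using close[OF e] by auto
    have "cmod (d m - d n) < \<epsilon>" if m: "m \<ge> max M N" and n: "n > m" for m n
    proof -
      have "cmod (d m - d n) \<le> e * cmod (d m)"
        using key[of e m "n - m"] M[of m] e m n by (simp add: norm_minus_commute)
      also have "\<dots> \<le> e * (2 * cmod (d N))"
        using size[of m] m e by (intro mult_left_mono) auto
      also have "\<dots> < \<epsilon>"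
        using dN \<open>0 < \<epsilon>\<close> by (simp add: e_def)
      finally show ?thesis .
    qed
    then show "\<exists>M. \<forall>m\<ge>M. \<forall>n>m. dist (d m) (d n) < \<epsilon>"
      unfolding dist_norm by blast
  qed
  then obtain \<beta> where \<beta>: "d \<longlonglongrightarrow> \<beta>"
    using Cauchy_convergent convergent_def by blast
  have "cmod (\<beta> - d N) \<le> 1 / 2 * cmod (d N)"
    using half by (intro tendsto_upperbound[OF tendsto_norm[OF tendsto_diff[OF \<beta> tendsto_const]]])
      (auto simp: eventually_sequentially)
  then have "\<beta> \<noteq> 0"
    using dN by auto
  with \<beta> show ?thesis
    using that by (simp add: d_def)
qed

text \<open>
  This is convergence of the Cesaro means of the increments, up to the term \<open>a 0 / n\<close>.
\<close>

lemma average_of_increments: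
  fixes a :: "nat \<Rightarrow> complex"
  assumes "(\<lambda>n. a (Suc n) - a n) \<longlonglongrightarrow> \<beta>"
  shows "(\<lambda>n. a n / of_nat n) \<longlonglongrightarrow> \<beta>"
proof (rule LIMSEQ_I)
  fix e :: real
  assume e: "0 < e"
  define b where "b = (\<lambda>n. a n - of_nat n * \<beta>)"
  have "b (Suc n) - b n = a (Suc n) - a n - \<beta>" for n
    by (simp add: b_def algebra_simps)
  then obtain N where N: "\<And>n. n \<ge> N \<Longrightarrow> cmod (b (Suc n) - b n) < e / 2"
    using LIMSEQ_D[OF assms, of "e / 2"] e by auto
  have growth: "cmod (b n) \<le> cmod (b N) + real n * (e / 2)" if "n \<ge> N" for n
    using that
  proof (induction n rule: dec_induct)
    case base
    then show ?case using e by simp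
  next
    case (step n)
    have "cmod (b (Suc n)) \<le> cmod (b n) + cmod (b (Suc n) - b n)"
      by (metis norm_triangle_sub)
    moreover have "cmod (b (Suc n) - b n) < e / 2" "cmod (b n) \<le> cmod (b N) + real n * (e / 2)"
      using step N[of n] by auto
    ultimately show ?case
      by (simp add: algebra_simps add_divide_distrib)
  qed
  obtain M where M: "cmod (b N) < real M * (e / 2)"
    using reals_Archimedean3[of "e / 2"] e by auto
  have "cmod (a n / of_nat n - \<beta>) < e" if "n \<ge> max (Suc M) N" for n
  proof -
    have n: "0 < real n"
      using that by auto
    have "cmod (b n) < real M * (e / 2) + real n * (e / 2)"
      using growth[of n] M that by auto
    also have "\<dots> \<le> real n * (e / 2) + real n * (e / 2)"
      using that e by (intro add_right_mono mult_right_mono) auto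
    finally have "cmod (b n) < real n * e"
      by (simp add: mult.commute)
    moreover have "a n / of_nat n - \<beta> = b n / of_nat n"
      using n by (simp add: b_def field_simps)
    ultimately show ?thesis
      using n by (simp add: norm_divide field_simps)
  qed
  then show "\<exists>N. \<forall>n\<ge>N. cmod (a n / of_nat n - \<beta>) < e"
    by blast
qed

section \<open>Parabolic semigroups of finite shift\<close>

text \<open>
  Outside the horocycle of size \<open>R\<close> means height at most \<open>1 / R\<close> in the half-plane; this is how
  finite shift enters, with \<open>Y = 1 / R\<close>.
\<close>

locale finite_shift_orbit =
  fixes \<phi> :: "real \<Rightarrow> complex \<Rightarrow> complex" and \<tau> z\<^sub>0 :: complex and Y :: real
  assumes semigroup: "holomorphic_semigroup \<phi>"
    and no_fixed_point: "0 < t \<Longrightarrow> z \<in> unit_disk \<Longrightarrow> \<phi> t z \<noteq> z"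
    and DW: "Denjoy_Wolff_point \<phi> \<tau>"
    and base: "z\<^sub>0 \<in> unit_disk"
    and orbit_bound: "0 \<le> t \<Longrightarrow> Im (cayley \<tau> (\<phi> t z\<^sub>0)) \<le> Y"
begin

lemma tau: "\<tau> \<in> sphere 0 1"
  using DW by (simp add: Denjoy_Wolff_point_def)

lemma hol: "0 \<le> t \<Longrightarrow> \<phi> t holomorphic_on unit_disk"
  and self_map: "0 \<le> t \<Longrightarrow> \<phi> t ` unit_disk \<subseteq> unit_disk"
  and at_0: "z \<in> unit_disk \<Longrightarrow> \<phi> 0 z = z"
  and add: "0 \<le> s \<Longrightarrow> 0 \<le> t \<Longrightarrow> z \<in> unit_disk \<Longrightarrow> \<phi> (t + s) z = \<phi> t (\<phi> s z)"
  using semigroup unfolding holomorphic_semigroup_def by blast+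

lemma in_disk: "0 \<le> t \<Longrightarrow> z \<in> unit_disk \<Longrightarrow> \<phi> t z \<in> unit_disk"
  using self_map by blast

lemma pointwise_limit: "z \<in> unit_disk \<Longrightarrow> ((\<lambda>t. \<phi> t z) \<longlongrightarrow> \<tau>) at_top"
proof -
  assume z: "z \<in> unit_disk"
  have "\<And>K. compact K \<Longrightarrow> K \<subseteq> unit_disk \<Longrightarrow> uniform_limit K \<phi> (\<lambda>_. \<tau>) at_top"
    using DW unfolding Denjoy_Wolff_point_def by blast
  from this[of "{z}"] show ?thesis
    using z by simp
qed

lemma Im_nondecreasing:
  assumes t: "0 \<le> t" and z: "z \<in> unit_disk"
  shows "Im (cayley \<tau> z) \<le> Im (cayley \<tau> (\<phi> t z))"
proof (cases "t = 0")
  case True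
  then show ?thesis
    using at_0[OF z] by simp
next
  case False
  have zero: "0 \<in> unit_disk"
    by simp
  have "(\<lambda>n. \<phi> (real n * t) 0) \<longlonglongrightarrow> \<tau>"
  proof (rule filterlim_compose[OF pointwise_limit[OF zero]])
    show "filterlim (\<lambda>n. real n * t) at_top sequentially"
      using t False by (intro filterlim_at_top_mult_tendsto_pos[OF tendsto_const _
            filterlim_real_sequentially]) auto
  qed
  moreover have "\<phi> (real (Suc n) * t) 0 = \<phi> t (\<phi> (real n * t) 0)" for n
    using add[of "real n * t" t 0] t by (simp add: algebra_simps)
  ultimately show ?thesis
    using Julia_inequality[OF hol[OF t] self_map[OF t] tau, of "\<lambda>n. \<phi> (real n * t) 0", OF _ _ _ z]
      in_disk[OF _ zero] t by simp
qed

text \<open>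
  The last two factors on the right are what finite shift makes small: they are the heights that remain
  to be gained by the orbits of \<open>z\<close> and \<open>w\<close>.
\<close>

lemma displacement_Schwarz_Pick:
  assumes t: "0 \<le> t" and z: "z \<in> unit_disk" and w: "w \<in> unit_disk"
  shows "(cmod ((cayley \<tau> (\<phi> t z) - cayley \<tau> (\<phi> t w)) - (cayley \<tau> z - cayley \<tau> w)))\<^sup>2
      * (Im (cayley \<tau> w) * Im (cayley \<tau> z))
    \<le> (cmod (cayley \<tau> z - cayley \<tau> w))\<^sup>2
      * ((Im (cayley \<tau> (\<phi> t w)) - Im (cayley \<tau> w)) * (Im (cayley \<tau> (\<phi> t z)) - Im (cayley \<tau> z)))"
proof -
  define P where "P = (\<lambda>x. cayley \<tau> (\<phi> t x) - cayley \<tau> x)"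
  have "(cayley \<tau> \<circ> \<phi> t) holomorphic_on unit_disk"
    using holomorphic_on_compose_gen[OF hol[OF t] cayley_holomorphic[OF tau] self_map[OF t]] .
  then have "P holomorphic_on unit_disk"
    unfolding P_def o_def by (intro holomorphic_intros cayley_holomorphic[OF tau])
  moreover have "0 \<le> Im (P x)" if "x \<in> unit_disk" for x
    using Im_nondecreasing[OF t that] by (simp add: P_def)
  ultimately have "(cmod (P z - P w))\<^sup>2 \<le> hyperbolic_gap z w * (Im (P z) * Im (P w))"
    using half_plane_Schwarz_Pick[OF _ _ z w] by blast
  moreover have pos: "0 < Im (cayley \<tau> w) * Im (cayley \<tau> z)"
    using Im_cayley_pos[OF tau] z w by simp
  ultimately have "(cmod (P z - P w))\<^sup>2 * (Im (cayley \<tau> w) * Im (cayley \<tau> z))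
      \<le> hyperbolic_gap z w * (Im (P z) * Im (P w)) * (Im (cayley \<tau> w) * Im (cayley \<tau> z))"
    by (intro mult_right_mono) auto
  also have "\<dots> = (cmod (cayley \<tau> z - cayley \<tau> w))\<^sup>2 * (Im (P w) * Im (P z))"
    by (simp add: hyperbolic_gap_cayley[OF tau z w] mult_ac)
  finally show ?thesis
    by (simp add: P_def algebra_simps)
qed

text \<open>
  The increments do not vanish because \<open>\<phi> h\<close> has no fixed point; the estimate on their variation
  is the displacement inequality at two consecutive orbit points.
\<close>

lemma discrete_orbit_speed:
  assumes h: "0 < h"
  obtains \<beta> where "\<beta> \<noteq> 0" "(\<lambda>n. cayley \<tau> (\<phi> (real n * h) z\<^sub>0) / of_nat n) \<longlonglongrightarrow> \<beta>"
proof -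
  define z where "z = (\<lambda>n::nat. \<phi> (real n * h) z\<^sub>0)"
  define a where "a = (\<lambda>n. cayley \<tau> (z n))"
  have z: "z n \<in> unit_disk" for n
    using in_disk base h by (simp add: z_def)
  have shift: "z (m + n) = \<phi> (real m * h) (z n)" for m n
    using add[of "real n * h" "real m * h" z\<^sub>0] base h by (simp add: z_def algebra_simps)
  have Suc: "z (Suc n) = \<phi> h (z n)" for n
    using shift[of 1 n] by simp
  obtain \<beta> where "\<beta> \<noteq> 0" "(\<lambda>n. a (Suc n) - a n) \<longlonglongrightarrow> \<beta>"
  proof (rule increments_converge_to_nonzero[of a Y])
    show "incseq (\<lambda>n. Im (a n))"
      using Im_nondecreasing[of h] h z by (auto intro!: incseq_SucI simp: a_def Suc)
    show "0 < Im (a 0)"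
      using Im_cayley_pos[OF tau z] by (simp add: a_def)
    show "Im (a n) \<le> Y" for n
      using orbit_bound h by (simp add: a_def z_def)
    show "a (Suc n) \<noteq> a n" for n
      using cayley_inj[OF tau z z, of "Suc n" n] no_fixed_point[OF h z] by (auto simp: a_def Suc)
    show "(cmod ((a (Suc (m + n)) - a (m + n)) - (a (Suc n) - a n)))\<^sup>2 * (Im (a n) * Im (a (Suc n)))
      \<le> (cmod (a (Suc n) - a n))\<^sup>2
        * ((Im (a (m + n)) - Im (a n)) * (Im (a (Suc (m + n))) - Im (a (Suc n))))" for m n
      using displacement_Schwarz_Pick[of "real m * h" "z (Suc n)" "z n"] z h
        shift[of m n] shift[of m "Suc n"] by (simp add: a_def)
  qed
  then show ?thesis
    using average_of_increments that by (simp add: a_def z_def)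
qed

text \<open>
  The Euclidean distance \<open>d\<close> of the two points satisfies \<open>d\<^sup>2 \<le> M p q\<close> with heights \<open>q \<le> Y\<close> and
  \<open>p \<le> Y + d\<close>. So \<open>d\<^sup>2 \<le> M Y (Y + d)\<close>, which fails once \<open>d\<close> exceeds \<open>(M + 1) Y\<close>: then
  \<open>M Y \<le> d - Y\<close>, and the right-hand side is at most \<open>d\<^sup>2 - Y\<^sup>2\<close>.
\<close>

lemma orbits_stay_close:
  assumes t: "0 \<le> t" and z: "z \<in> unit_disk" and gap: "hyperbolic_gap z z\<^sub>0 \<le> M"
  shows "cmod (cayley \<tau> (\<phi> t z) - cayley \<tau> (\<phi> t z\<^sub>0)) \<le> (M + 1) * Y"
proof (rule ccontr)
  define d where "d = cmod (cayley \<tau> (\<phi> t z) - cayley \<tau> (\<phi> t z\<^sub>0))"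
  assume "\<not> ?thesis"
  then have far: "(M + 1) * Y < d"
    by (simp add: d_def)
  define p where "p = Im (cayley \<tau> (\<phi> t z))"
  define q where "q = Im (cayley \<tau> (\<phi> t z\<^sub>0))"
  have p: "0 < p" and q: "0 < q" "q \<le> Y"
    using Im_cayley_pos[OF tau] in_disk[OF t] z base orbit_bound[OF t] by (simp_all add: p_def q_def)
  have M: "0 \<le> M"
    using hyperbolic_gap_nonneg[OF z base] gap by linarith
  have "hyperbolic_gap (\<phi> t z) (\<phi> t z\<^sub>0) \<le> M"
    using hyperbolic_gap_contraction[OF hol[OF t] self_map[OF t] z base] gap by linarith
  then have "d\<^sup>2 \<le> M * (p * q)"
    using p q by (simp add: d_def p_def q_def hyperbolic_gap_cayley[OF tau in_disk[OF t z] in_disk[OF t base]])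
  also have "\<dots> \<le> M * ((Y + d) * Y)"
  proof (intro mult_left_mono mult_mono)
    show "p \<le> Y + d"
      using abs_Im_le_cmod[of "cayley \<tau> (\<phi> t z) - cayley \<tau> (\<phi> t z\<^sub>0)"] q
      by (simp add: d_def p_def q_def)
  qed (use M p q d_def in auto)
  also have "\<dots> < d * d"
  proof -
    have "0 < Y"
      using q by linarith
    then have "0 \<le> M * Y"
      using M by simp
    then have "Y < d" "M * Y \<le> d - Y"
      using far \<open>0 < Y\<close> by (auto simp: algebra_simps)
    have "M * ((Y + d) * Y) = (M * Y) * (Y + d)"
      by simp
    also have "\<dots> \<le> (d - Y) * (Y + d)"
      using \<open>M * Y \<le> d - Y\<close> \<open>Y < d\<close> \<open>0 < Y\<close> by (intro mult_right_mono) auto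
    also have "\<dots> < d * d"
      using \<open>0 < Y\<close> by (simp add: algebra_simps)
    finally show ?thesis .
  qed
  finally show False
    by (simp add: power2_eq_square)
qed

text \<open>
  Continuity of the semigroup is known at time \<open>0\<close>, so the time step is chosen small enough
  for the orbit to move only a little within one step.
\<close>

lemma small_time_gap:
  obtains h where "0 < h" "\<And>s. 0 \<le> s \<Longrightarrow> s \<le> h \<Longrightarrow> hyperbolic_gap (\<phi> s z\<^sub>0) z\<^sub>0 \<le> 1"
proof -
  have "\<And>K. compact K \<Longrightarrow> K \<subseteq> unit_disk \<Longrightarrow> uniform_limit K \<phi> (\<lambda>z. z) (at_right 0)"
    using semigroup unfolding holomorphic_semigroup_def by blast
  from this[of "{z\<^sub>0}"] have lim: "((\<lambda>s. \<phi> s z\<^sub>0) \<longlongrightarrow> z\<^sub>0) (at_right 0)"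
    using base by simp
  have "((\<lambda>s. hyperbolic_gap (\<phi> s z\<^sub>0) z\<^sub>0) \<longlongrightarrow> hyperbolic_gap z\<^sub>0 z\<^sub>0) (at_right 0)"
    unfolding hyperbolic_gap_def using one_minus_cmod_square_pos[OF base]
    by (intro tendsto_intros lim) auto
  then have "\<forall>\<^sub>F s in at_right 0. hyperbolic_gap (\<phi> s z\<^sub>0) z\<^sub>0 < 1"
    by (rule order_tendstoD) (simp add: hyperbolic_gap_def)
  then obtain b where b: "0 < b" "\<And>s. 0 < s \<Longrightarrow> s < b \<Longrightarrow> hyperbolic_gap (\<phi> s z\<^sub>0) z\<^sub>0 < 1"
    by (auto simp: eventually_at_right_field)
  show ?thesis
  proof (rule that[of "b / 2"])
    show "hyperbolic_gap (\<phi> s z\<^sub>0) z\<^sub>0 \<le> 1" if "0 \<le> s" "s \<le> b / 2" for s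
      using b that by (cases "s = 0") (auto simp: at_0[OF base] hyperbolic_gap_def[of z\<^sub>0] less_imp_le)
  qed (use b in simp)
qed

lemma uniform_speed:
  obtains \<gamma> where "\<gamma> \<noteq> 0"
    "\<And>K. compact K \<Longrightarrow> K \<subseteq> unit_disk \<Longrightarrow>
      uniform_limit K (\<lambda>t z. (cayley \<tau> (\<phi> t z) + \<i>) / of_real t) (\<lambda>_. \<gamma>) at_top"
proof -
  obtain h where h: "0 < h" "\<And>s. 0 \<le> s \<Longrightarrow> s \<le> h \<Longrightarrow> hyperbolic_gap (\<phi> s z\<^sub>0) z\<^sub>0 \<le> 1"
    using small_time_gap by blast
  define a where "a = (\<lambda>n::nat. cayley \<tau> (\<phi> (real n * h) z\<^sub>0))"
  obtain \<beta> where \<beta>: "\<beta> \<noteq> 0" "(\<lambda>n. a n / of_nat n) \<longlonglongrightarrow> \<beta>"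
    using discrete_orbit_speed[OF h(1)] unfolding a_def by blast
  define N where "N = (\<lambda>t. nat \<lfloor>t / h\<rfloor>)"
  have N: "real (N t) * h \<le> t" "t - real (N t) * h \<le> h" if "0 \<le> t" for t
  proof -
    have *: "real (N t) \<le> t / h" "t / h \<le> real (N t) + 1"
      using that h(1) by (auto simp: N_def of_nat_nat)
    then show "real (N t) * h \<le> t" "t - real (N t) * h \<le> h"
      using h(1) by (simp_all add: field_simps)
  qed
  have lim_N: "((\<lambda>t. a (N t) / of_real t) \<longlongrightarrow> \<beta> / of_real h) at_top"
  proof -
    have N_top: "filterlim N at_top at_top"
      unfolding N_def using h(1) by real_asymp
    have "((\<lambda>t. real (N t) / t) \<longlongrightarrow> 1 / h) at_top"
      unfolding N_def inverse_eq_divide[symmetric] using h(1) by real_asymp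
    then have "((\<lambda>t. complex_of_real (real (N t) / t)) \<longlongrightarrow> complex_of_real (1 / h)) at_top"
      by (rule tendsto_of_real)
    then have "((\<lambda>t. a (N t) / of_nat (N t) * complex_of_real (real (N t) / t))
        \<longlongrightarrow> \<beta> * complex_of_real (1 / h)) at_top"
      by (intro tendsto_mult filterlim_compose[OF \<beta>(2) N_top])
    \<comment> \<open>The factor \<open>N t\<close> cancels only once it is positive, that is from \<open>t = h\<close> on.\<close>
    moreover have "\<forall>\<^sub>F t in at_top. a (N t) / of_nat (N t) * complex_of_real (real (N t) / t)
        = a (N t) / of_real t"
      using eventually_compose_filterlim[OF eventually_gt_at_top[of 0] N_top]
      by eventually_elim simp
    ultimately have "((\<lambda>t. a (N t) / of_real t) \<longlongrightarrow> \<beta> * complex_of_real (1 / h)) at_top"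
      by (rule Lim_transform_eventually)
    then show ?thesis
      by simp
  qed
  show ?thesis
  proof (rule that[of "\<beta> / of_real h"])
    show "\<beta> / of_real h \<noteq> 0"
      using \<beta>(1) h(1) by simp
  next
    fix K
    assume K: "compact K" "K \<subseteq> unit_disk"
    have "continuous_on K (\<lambda>z. hyperbolic_gap z z\<^sub>0)"
      unfolding hyperbolic_gap_def using one_minus_cmod_square_pos K(2) base
      by (intro continuous_intros) force
    then have "bounded ((\<lambda>z. hyperbolic_gap z z\<^sub>0) ` K)"
      using K(1) compact_continuous_image compact_imp_bounded by blast
    then obtain M where "\<And>z. z \<in> K \<Longrightarrow> \<bar>hyperbolic_gap z z\<^sub>0\<bar> \<le> M"
      unfolding bounded_real by blast
    then have M: "hyperbolic_gap z z\<^sub>0 \<le> M" if "z \<in> K" for z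
      using that abs_le_D1 by blast
    \<comment> \<open>The three terms account for moving from \<open>z\<close> to \<open>z\<^sub>0\<close>, from \<open>t\<close> down to a multiple of \<open>h\<close>
        (gap at most \<open>1\<close>, whence \<open>(1 + 1) * Y\<close>), and for the summand \<open>\<i>\<close>.\<close>
    define L where "L = (M + 1) * Y + 2 * Y + 1"
    have close: "cmod (cayley \<tau> (\<phi> t z) + \<i> - a (N t)) \<le> L" if t: "0 \<le> t" and z: "z \<in> K" for t z
    proof -
      define r where "r = real (N t) * h"
      have r: "0 \<le> r" "0 \<le> t - r" "t - r \<le> h"
        using N[OF t] h(1) by (auto simp: r_def)
      have "cmod (cayley \<tau> (\<phi> t z) - cayley \<tau> (\<phi> t z\<^sub>0)) \<le> (M + 1) * Y"
        using orbits_stay_close[OF t _ M[OF z]] K z by blast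
      moreover have "cmod (cayley \<tau> (\<phi> t z\<^sub>0) - a (N t)) \<le> 2 * Y"
        using orbits_stay_close[OF r(1) in_disk[OF r(2) base] h(2)[OF r(2,3)]]
          add[OF r(2,1) base] by (simp add: a_def r_def)
      moreover have "cmod (cayley \<tau> (\<phi> t z) + \<i> - a (N t)) \<le>
          cmod (cayley \<tau> (\<phi> t z) - cayley \<tau> (\<phi> t z\<^sub>0)) + cmod (cayley \<tau> (\<phi> t z\<^sub>0) - a (N t)) + cmod \<i>"
        using norm_triangle_ineq[of "cayley \<tau> (\<phi> t z) - cayley \<tau> (\<phi> t z\<^sub>0)
            + (cayley \<tau> (\<phi> t z\<^sub>0) - a (N t))" \<i>]
          norm_triangle_ineq[of "cayley \<tau> (\<phi> t z) - cayley \<tau> (\<phi> t z\<^sub>0)"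
            "cayley \<tau> (\<phi> t z\<^sub>0) - a (N t)"]
        by (simp add: algebra_simps)
      ultimately show ?thesis
        by (simp add: L_def)
    qed
    have "uniform_limit K (\<lambda>t z. (cayley \<tau> (\<phi> t z) + \<i> - a (N t)) / of_real t) (\<lambda>_. 0) at_top"
    proof (rule uniform_limit_null_comparison)
      show "\<forall>\<^sub>F t in at_top. \<forall>z\<in>K. norm ((cayley \<tau> (\<phi> t z) + \<i> - a (N t)) / of_real t) \<le> L / t"
        using eventually_gt_at_top[of 0]
        by eventually_elim (simp add: norm_divide divide_right_mono close)
      have "((\<lambda>t. L / t) \<longlongrightarrow> 0) at_top"
        by real_asymp
      then show "uniform_limit K (\<lambda>t _. L / t) (\<lambda>_. 0) at_top"
        by (simp add: uniform_limit_iff tendsto_iff)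
    qed
    moreover have "uniform_limit K (\<lambda>t _. a (N t) / of_real t) (\<lambda>_. \<beta> / of_real h) at_top"
      using lim_N by (simp add: uniform_limit_iff tendsto_iff)
    ultimately have "uniform_limit K
        (\<lambda>t z. (cayley \<tau> (\<phi> t z) + \<i> - a (N t)) / of_real t + a (N t) / of_real t)
        (\<lambda>_. 0 + \<beta> / of_real h) at_top"
      by (rule uniform_limit_add)
    then show "uniform_limit K (\<lambda>t z. (cayley \<tau> (\<phi> t z) + \<i>) / of_real t) (\<lambda>_. \<beta> / of_real h) at_top"
      by (simp add: diff_divide_distrib)
  qed
qed

lemma rate_of_convergence:
  obtains C where "0 < C"
    "\<And>K. compact K \<Longrightarrow> K \<subseteq> unit_disk \<Longrightarrow>
      uniform_limit K (\<lambda>t z. t * cmod (\<phi> t z - \<tau>)) (\<lambda>_. C) at_top"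
proof -
  obtain \<gamma> where \<gamma>: "\<gamma> \<noteq> 0" "\<And>K. compact K \<Longrightarrow> K \<subseteq> unit_disk \<Longrightarrow>
      uniform_limit K (\<lambda>t z. (cayley \<tau> (\<phi> t z) + \<i>) / of_real t) (\<lambda>_. \<gamma>) at_top"
    using uniform_speed by blast
  show ?thesis
  proof (rule that[of "2 / cmod \<gamma>"])
    fix K
    assume K: "compact K" "K \<subseteq> unit_disk"
    have "uniform_limit K (\<lambda>t z. 2 / cmod ((cayley \<tau> (\<phi> t z) + \<i>) / of_real t))
        (\<lambda>_. 2 / cmod \<gamma>) at_top"
      using \<gamma>(1) by (intro uniform_lim_divide[where b = "cmod \<gamma>"] uniform_limit_norm
          \<gamma>(2)[OF K] uniform_limit_const) (auto simp: image_constant_conv)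
    moreover have "\<forall>\<^sub>F t in at_top. \<forall>z\<in>K. 2 / cmod ((cayley \<tau> (\<phi> t z) + \<i>) / of_real t)
        = t * cmod (\<phi> t z - \<tau>)"
      using eventually_gt_at_top[of 0]
    proof eventually_elim
      case (elim t)
      then show ?case
        using K(2) cmod_boundary_point_diff[OF tau in_disk[of t]] by (auto simp: norm_divide)
    qed
    ultimately show "uniform_limit K (\<lambda>t z. t * cmod (\<phi> t z - \<tau>)) (\<lambda>_. 2 / cmod \<gamma>) at_top"
      by (rule uniform_limit_cong[THEN iffD1, rotated 2]) auto
  qed (use \<gamma>(1) in simp)
qed

lemma time_one_iterates: "((restrict (\<phi> 1) unit_disk) ^^ n) 0 = \<phi> (real n) 0"
proof (induction n)
  case 0
  then show ?case
    by (simp add: at_0)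
next
  case (Suc n)
  then show ?case
    using add[of "real n" 1 0] in_disk[of "real n" 0] by (simp add: add.commute)
qed

end

text \<open>
  The inner limit recovers the Denjoy-Wolff point from the iterates, so that the rate is a function
  of the map alone. The base point \<open>0\<close> is an arbitrary choice in the disk.
\<close>

definition iteration_rate :: "(complex \<Rightarrow> complex) \<Rightarrow> real" where
  "iteration_rate h = lim (\<lambda>n. real n * cmod ((h ^^ n) 0 - lim (\<lambda>m. (h ^^ m) 0)))"

lemma finite_shift_imp_bounded_orbit:
  assumes "parabolic_semigroup \<phi> \<tau>" "finite_shift \<phi> \<tau>"
  obtains z\<^sub>0 Y where "finite_shift_orbit \<phi> \<tau> z\<^sub>0 Y"
proof -
  have semigroup: "holomorphic_semigroup \<phi>" "\<And>t z. 0 < t \<Longrightarrow> z \<in> unit_disk \<Longrightarrow> \<phi> t z \<noteq> z"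
    and DW: "Denjoy_Wolff_point \<phi> \<tau>"
    using assms(1) by (auto simp: parabolic_semigroup_def nonelliptic_semigroup_def)
  obtain z\<^sub>0 R where z0: "z\<^sub>0 \<in> unit_disk" "0 < R" "\<And>t. 0 \<le> t \<Longrightarrow> \<phi> t z\<^sub>0 \<notin> horocycle \<tau> R"
    using assms(2) by (auto simp: finite_shift_def)
  have tau: "\<tau> \<in> sphere 0 1"
    using DW by (simp add: Denjoy_Wolff_point_def)
  have "Im (cayley \<tau> (\<phi> t z\<^sub>0)) \<le> 1 / R" if t: "0 \<le> t" for t
  proof -
    have d: "\<phi> t z\<^sub>0 \<in> unit_disk"
      using semigroup(1) t z0(1) unfolding holomorphic_semigroup_def by blast
    then have "R \<le> (cmod (\<tau> - \<phi> t z\<^sub>0))\<^sup>2 / (1 - (cmod (\<phi> t z\<^sub>0))\<^sup>2)"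
      using z0(3)[OF t] by (auto simp: horocycle_def)
    also have "\<dots> = 1 / Im (cayley \<tau> (\<phi> t z\<^sub>0))"
      by (simp add: Im_cayley[OF tau d])
    finally show ?thesis
      using z0(2) Im_cayley_pos[OF tau d] by (simp add: field_simps)
  qed
  then have "finite_shift_orbit \<phi> \<tau> z\<^sub>0 (1 / R)"
    using semigroup DW z0(1) by (unfold_locales) auto
  then show ?thesis
    by (rule that)
qed

theorem theorem4p2:
  "\<exists>C :: (complex \<Rightarrow> complex) \<Rightarrow> real.
     \<forall>(\<phi> :: real \<Rightarrow> complex \<Rightarrow> complex) (\<tau> :: complex).
       parabolic_semigroup \<phi> \<tau> \<and> finite_shift \<phi> \<tau> \<longrightarrow>
         C (restrict (\<phi> 1) unit_disk) > 0 \<and>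
         (\<forall>K. compact K \<and> K \<subseteq> unit_disk \<longrightarrow>
            uniform_limit K (\<lambda>t z. t * cmod (\<phi> t z - \<tau>))
              (\<lambda>_. C (restrict (\<phi> 1) unit_disk)) at_top)"
proof (rule exI[of _ iteration_rate], intro allI impI, elim conjE)
  fix \<phi> :: "real \<Rightarrow> complex \<Rightarrow> complex" and \<tau> :: complex
  assume "parabolic_semigroup \<phi> \<tau>" "finite_shift \<phi> \<tau>"
  then obtain z\<^sub>0 Y where "finite_shift_orbit \<phi> \<tau> z\<^sub>0 Y"
    by (rule finite_shift_imp_bounded_orbit)
  then interpret finite_shift_orbit \<phi> \<tau> z\<^sub>0 Y .
  obtain C where C: "0 < C" "\<And>K. compact K \<Longrightarrow> K \<subseteq> unit_disk \<Longrightarrow>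
      uniform_limit K (\<lambda>t z. t * cmod (\<phi> t z - \<tau>)) (\<lambda>_. C) at_top"
    using rate_of_convergence by blast
  have "(\<lambda>m. \<phi> (real m) 0) \<longlonglongrightarrow> \<tau>"
    by (rule filterlim_compose[OF pointwise_limit filterlim_real_sequentially]) simp
  then have tau_lim: "lim (\<lambda>m. \<phi> (real m) 0) = \<tau>"
    by (rule limI)
  have "((\<lambda>t. t * cmod (\<phi> t 0 - \<tau>)) \<longlongrightarrow> C) at_top"
    using tendsto_uniform_limitI[OF C(2)[of "{0}"], of 0] by simp
  then have "(\<lambda>n. real n * cmod (\<phi> (real n) 0 - \<tau>)) \<longlonglongrightarrow> C"
    by (rule filterlim_compose[OF _ filterlim_real_sequentially])
  then have "iteration_rate (restrict (\<phi> 1) unit_disk) = C"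
    unfolding iteration_rate_def time_one_iterates tau_lim by (rule limI)
  then show "0 < iteration_rate (restrict (\<phi> 1) unit_disk) \<and>
      (\<forall>K. compact K \<and> K \<subseteq> unit_disk \<longrightarrow>
        uniform_limit K (\<lambda>t z. t * cmod (\<phi> t z - \<tau>))
          (\<lambda>_. iteration_rate (restrict (\<phi> 1) unit_disk)) at_top)"
    using C by simp
qed

end
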